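(* Let $\alpha\colon(0,\infty)\to(0,\infty)$ be a Lipschitz map with $D(\alpha)<\infty$. For any bi-Lipschitz zero-preserving map $f\colon\mathcal{M}\to\mathcal{N}$ between pointed metric spaces, consider $\mathcal{B}(f)\colon\mathcal{B}(\mathcal{M})\to\mathcal{B}(\mathcal{N})$ defined by $\mathcal{B}(f)(\mu(x)):=\mu(f(x))$, $x\in\mathcal{M}$. Then: (i) $\mathcal{B}(\mathrm{id})=\mathrm{id}$, and $\mathcal{B}(f\circ g)=\mathcal{B}(f)\circ\mathcal{B}(g)$ for all bi-Lipschitz zero-preserving maps $g\colon\mathcal{M}\to\mathcal{N}$ and $f\colon\mathcal{N}\to\mathcal{K}$ between pointed metric spaces. (ii) $\mathcal{B}(f)$ is a bi-Lipschitz zero-preserving map for every bi-Lipschitz zero-preserving map $f\colon\mathcal{M}\to\mathcal{N}$ between pointed metric spaces.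
   Context: The scalar field is $\mathbb{R}$ or $\mathbb{C}$. A pointed metric space is a metric space with a distinguished point $0$. A map $f$ is bi-Lipschitz if there are $0<a\le b<\infty$ with $a\,d(x,y)\le d(f(x),f(y))\le b\,d(x,y)$ for all $x,y$ (it need not be surjective); it is zero-preserving if $f(0)=0$. $D(\alpha)=\sup_{t>0}t/\alpha(t)$. $\mathcal{F}(\mathcal{M})$ is the Lipschitz-free space over $\mathcal{M}$, i.e. the closed linear span of the evaluation functionals $\delta_{\mathcal{M}}(x)\colon f\mapsto f(x)$ in the dual of the Banach space $\mathrm{Lip}_0(\mathcal{M})$ of scalar Lipschitz functions vanishing at $0$ (normed by the least Lipschitz constant). For each pointed metric space $(\mathcal{M},d,0)$ put $\mu(0)=0$ and $\mu(x)=\delta_{\mathcal{M}}(x)/\alpha(d(0,x))\in\mathcal{F}(\mathcal{M})$ for $x\ne0$ (the same letter $\mu$ is used for every space; this map is injective). $\mathcal{B}(\mathcal{M})=\{\mu(x)\colon x\in\mathcal{M}\}\subset\mathcal{F}(\mathcal{M})$ with the metric induced by the norm and base point $0$. *)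

theory Defs
  imports "HOL-Analysis.Analysis"
begin

text \<open>The type class \<open>real_normed_field\<close> plays the role of the scalar field: up to isometric
  isomorphism its only instances are the reals and the complex numbers (and both are instances),
  because the norm of a \<open>real_normed_field\<close> is multiplicative.\<close>

definition pointed_metric :: "'a metric \<Rightarrow> 'a \<Rightarrow> bool" where
  "pointed_metric M o\<^sub>M \<longleftrightarrow> o\<^sub>M \<in> mspace M"

definition bilipschitz_map :: "'a metric \<Rightarrow> 'b metric \<Rightarrow> ('a \<Rightarrow> 'b) \<Rightarrow> bool" where
  "bilipschitz_map M N f \<longleftrightarrow> f \<in> mspace M \<rightarrow> mspace N \<and>
     (\<exists>a b. 0 < a \<and> a \<le> b \<and>
       (\<forall>x\<in>mspace M. \<forall>y\<in>mspace M.
          a * mdist M x y \<le> mdist N (f x) (f y) \<and> mdist N (f x) (f y) \<le> b * mdist M x y))"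

definition bilipschitz_pointed ::
    "'a metric \<Rightarrow> 'a \<Rightarrow> 'b metric \<Rightarrow> 'b \<Rightarrow> ('a \<Rightarrow> 'b) \<Rightarrow> bool" where
  "bilipschitz_pointed M o\<^sub>M N o\<^sub>N f \<longleftrightarrow> bilipschitz_map M N f \<and> f o\<^sub>M = o\<^sub>N"

definition D_const :: "(real \<Rightarrow> real) \<Rightarrow> ereal" where
  "D_const \<alpha> = (SUP t\<in>{0<..}. ereal (t / \<alpha> t))"

text \<open>A function on the carrier is represented by its extension by \<open>0\<close> to the whole type, so that
  elements are determined by their values on the carrier.\<close>

definition Lip0 :: "'a metric \<Rightarrow> 'a \<Rightarrow> ('a \<Rightarrow> 'k::real_normed_field) set" where
  "Lip0 M o\<^sub>M = {g. Lipschitz_continuous_map M euclidean_metric g \<and> g o\<^sub>M = 0 \<and>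
                   (\<forall>x. x \<notin> mspace M \<longrightarrow> g x = 0)}"

definition Lip_norm :: "'a metric \<Rightarrow> ('a \<Rightarrow> 'k::real_normed_field) \<Rightarrow> real" where
  "Lip_norm M g = Inf {L. 0 \<le> L \<and>
     (\<forall>x\<in>mspace M. \<forall>y\<in>mspace M. norm (g x - g y) \<le> L * mdist M x y)}"

text \<open>Functionals are likewise extended by \<open>0\<close> to all functions.\<close>

definition Lip0_dual :: "'a metric \<Rightarrow> 'a \<Rightarrow> (('a \<Rightarrow> 'k::real_normed_field) \<Rightarrow> 'k) set" where
  "Lip0_dual M o\<^sub>M = {\<phi>.
     (\<forall>g\<in>Lip0 M o\<^sub>M. \<forall>h\<in>Lip0 M o\<^sub>M. \<phi> (\<lambda>x. g x + h x) = \<phi> g + \<phi> h) \<and>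
     (\<forall>c. \<forall>g\<in>Lip0 M o\<^sub>M. \<phi> (\<lambda>x. c * g x) = c * \<phi> g) \<and>
     (\<exists>K. \<forall>g\<in>Lip0 M o\<^sub>M. norm (\<phi> g) \<le> K * Lip_norm M g) \<and>
     (\<forall>g. g \<notin> Lip0 M o\<^sub>M \<longrightarrow> \<phi> g = 0)}"

definition dual_norm ::
    "'a metric \<Rightarrow> 'a \<Rightarrow> (('a \<Rightarrow> 'k::real_normed_field) \<Rightarrow> 'k) \<Rightarrow> real" where
  "dual_norm M o\<^sub>M \<phi> = (SUP g\<in>{g \<in> Lip0 M o\<^sub>M. Lip_norm M g \<le> 1}. norm (\<phi> g))"

text \<open>The locale \<open>Metric_space\<close> requires nonnegativity and symmetry of the distance also outside
  the carrier, whence the value \<open>0\<close> there.\<close>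

definition dual_dist :: "'a metric \<Rightarrow> 'a \<Rightarrow> (('a \<Rightarrow> 'k::real_normed_field) \<Rightarrow> 'k)
    \<Rightarrow> (('a \<Rightarrow> 'k) \<Rightarrow> 'k) \<Rightarrow> real" where
  "dual_dist M o\<^sub>M \<phi> \<psi> =
     (if \<phi> \<in> Lip0_dual M o\<^sub>M \<and> \<psi> \<in> Lip0_dual M o\<^sub>M
      then dual_norm M o\<^sub>M (\<lambda>g. \<phi> g - \<psi> g) else 0)"

definition dual_metric ::
    "'a metric \<Rightarrow> 'a \<Rightarrow> (('a \<Rightarrow> 'k::real_normed_field) \<Rightarrow> 'k) metric" where
  "dual_metric M o\<^sub>M = metric (Lip0_dual M o\<^sub>M, dual_dist M o\<^sub>M)"

definition delta ::
    "'a metric \<Rightarrow> 'a \<Rightarrow> 'a \<Rightarrow> ('a \<Rightarrow> 'k::real_normed_field) \<Rightarrow> 'k" where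
  "delta M o\<^sub>M x = (\<lambda>g. if g \<in> Lip0 M o\<^sub>M then g x else 0)"

definition delta_span ::
    "'a metric \<Rightarrow> 'a \<Rightarrow> (('a \<Rightarrow> 'k::real_normed_field) \<Rightarrow> 'k) set" where
  "delta_span M o\<^sub>M =
     {\<lambda>g. \<Sum>x\<in>A. c x * delta M o\<^sub>M x g | A c. finite A \<and> A \<subseteq> mspace M}"

definition free_space ::
    "'a metric \<Rightarrow> 'a \<Rightarrow> (('a \<Rightarrow> 'k::real_normed_field) \<Rightarrow> 'k) metric" where
  "free_space M o\<^sub>M =
     submetric (dual_metric M o\<^sub>M)
       (mtopology_of (dual_metric M o\<^sub>M) closure_of delta_span M o\<^sub>M)"

definition mu :: "(real \<Rightarrow> real) \<Rightarrow> 'a metric \<Rightarrow> 'a \<Rightarrow> 'a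
    \<Rightarrow> ('a \<Rightarrow> 'k::real_normed_field) \<Rightarrow> 'k" where
  "mu \<alpha> M o\<^sub>M x =
     (if x = o\<^sub>M then (\<lambda>g. 0)
      else (\<lambda>g. delta M o\<^sub>M x g / of_real (\<alpha> (mdist M o\<^sub>M x))))"

definition B_space :: "(real \<Rightarrow> real) \<Rightarrow> 'a metric \<Rightarrow> 'a
    \<Rightarrow> (('a \<Rightarrow> 'k::real_normed_field) \<Rightarrow> 'k) metric" where
  "B_space \<alpha> M o\<^sub>M = submetric (free_space M o\<^sub>M) (mu \<alpha> M o\<^sub>M ` mspace M)"

text \<open>For positive \<open>\<alpha>\<close> the map \<open>mu \<alpha> M o\<^sub>M\<close> is injective on the carrier, so the preimage below is
  unique on \<open>B_space \<alpha> M o\<^sub>M\<close>; off that space the value is unspecified.\<close>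

definition B_map :: "(real \<Rightarrow> real) \<Rightarrow> 'a metric \<Rightarrow> 'a \<Rightarrow> 'b metric \<Rightarrow> 'b \<Rightarrow> ('a \<Rightarrow> 'b)
    \<Rightarrow> (('a \<Rightarrow> 'k::real_normed_field) \<Rightarrow> 'k) \<Rightarrow> (('b \<Rightarrow> 'k) \<Rightarrow> 'k)" where
  "B_map \<alpha> M o\<^sub>M N o\<^sub>N f = (\<lambda>\<phi>. mu \<alpha> N o\<^sub>N (f (inv_into (mspace M) (mu \<alpha> M o\<^sub>M) \<phi>)))"

lemma Lip_norm_bound:
  fixes g :: "'a \<Rightarrow> 'k::real_normed_field"
  assumes g: "g \<in> Lip0 M z" and x: "x \<in> mspace M" and y: "y \<in> mspace M"
  shows "norm (g x - g y) \<le> Lip_norm M g * mdist M x y"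
proof (cases "x = y")
  case True
  then show ?thesis
    using x by (simp add: Metric_space.mdist_zero[OF Metric_space_mspace_mdist])
next
  case False
  then have d: "mdist M x y > 0"
    using x y by (simp add: less_le)
  let ?S = "{L. 0 \<le> L \<and> (\<forall>x\<in>mspace M. \<forall>y\<in>mspace M. norm (g x - g y) \<le> L * mdist M x y)}"
  have "Lipschitz_continuous_map M euclidean_metric g"
    using g by (simp add: Lip0_def)
  then obtain B where "B > 0"
      "\<forall>x\<in>mspace M. \<forall>y\<in>mspace M. mdist euclidean_metric (g x) (g y) \<le> B * mdist M x y"
    unfolding Lipschitz_continuous_map_pos by blast
  then have "B \<in> ?S"
    by (simp add: dist_norm)
  then have ne: "?S \<noteq> {}"
    by blast
  have "norm (g x - g y) / mdist M x y \<le> Inf ?S"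
    using x y d by (intro cInf_greatest[OF ne]) (auto simp: field_simps)
  then show ?thesis
    using d by (simp add: Lip_norm_def field_simps)
qed

lemma Lip_norm_le:
  assumes "0 \<le> L" "\<And>x y. x \<in> mspace M \<Longrightarrow> y \<in> mspace M \<Longrightarrow> norm (g x - g y) \<le> L * mdist M x y"
  shows "Lip_norm M g \<le> L"
  unfolding Lip_norm_def using assms by (intro cInf_lower) (auto intro: bdd_belowI[of _ 0])

lemma Lip_norm_nonneg:
  assumes "g \<in> Lip0 M z"
  shows "0 \<le> Lip_norm M g"
proof -
  have "Lipschitz_continuous_map M euclidean_metric g"
    using assms by (simp add: Lip0_def)
  then obtain B where "B > 0"
      "\<forall>x\<in>mspace M. \<forall>y\<in>mspace M. mdist euclidean_metric (g x) (g y) \<le> B * mdist M x y"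
    unfolding Lipschitz_continuous_map_pos by blast
  then have "B \<in> {L. 0 \<le> L \<and> (\<forall>x\<in>mspace M. \<forall>y\<in>mspace M. norm (g x - g y) \<le> L * mdist M x y)}"
    by (simp add: dist_norm)
  then have ne: "{L. 0 \<le> L \<and> (\<forall>x\<in>mspace M. \<forall>y\<in>mspace M. norm (g x - g y) \<le> L * mdist M x y)} \<noteq> {}"
    by blast
  show ?thesis
    unfolding Lip_norm_def by (intro cInf_greatest[OF ne]) auto
qed

lemma zero_in_Lip0: "(\<lambda>x. 0) \<in> Lip0 M z"
  by (auto simp: Lip0_def Lipschitz_continuous_map_def intro!: exI[of _ 0])

lemma scale_in_Lip0:
  fixes c :: "'k::real_normed_field"
  assumes g: "g \<in> Lip0 M z"
  shows "(\<lambda>x. c * g x) \<in> Lip0 M z"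
proof -
  have "dist (c * g x) (c * g y) \<le> (norm c * Lip_norm M g) * mdist M x y"
    if "x \<in> mspace M" "y \<in> mspace M" for x y
  proof -
    have "dist (c * g x) (c * g y) = norm c * norm (g x - g y)"
      by (simp add: dist_norm norm_mult flip: right_diff_distrib)
    also have "\<dots> \<le> norm c * (Lip_norm M g * mdist M x y)"
      using Lip_norm_bound[OF g that] by (intro mult_left_mono) auto
    finally show ?thesis by (simp add: mult.assoc)
  qed
  then show ?thesis
    using g unfolding Lip0_def Lipschitz_continuous_map_def by auto
qed

lemma dual_norm_bdd:
  assumes "\<phi> \<in> Lip0_dual M z"
  shows "\<exists>C. \<forall>g\<in>{g \<in> Lip0 M z. Lip_norm M g \<le> 1}. norm (\<phi> g) \<le> C"
proof -
  obtain K where K: "\<And>g. g \<in> Lip0 M z \<Longrightarrow> norm (\<phi> g) \<le> K * Lip_norm M g"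
    using assms unfolding Lip0_dual_def by blast
  have "norm (\<phi> g) \<le> \<bar>K\<bar>" if "g \<in> Lip0 M z" "Lip_norm M g \<le> 1" for g
  proof -
    have "norm (\<phi> g) \<le> K * Lip_norm M g" by (rule K[OF that(1)])
    also have "\<dots> \<le> \<bar>K\<bar> * Lip_norm M g"
      using Lip_norm_nonneg[OF that(1)] by (intro mult_right_mono) auto
    also have "\<dots> \<le> \<bar>K\<bar>"
      using that(2) by (simp add: mult_left_le)
    finally show ?thesis .
  qed
  then show ?thesis by blast
qed

lemma dual_dist_bdd:
  assumes "\<phi> \<in> Lip0_dual M z" "\<psi> \<in> Lip0_dual M z"
  shows "bdd_above ((\<lambda>g. norm (\<phi> g - \<psi> g)) ` {g \<in> Lip0 M z. Lip_norm M g \<le> 1})"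
proof -
  obtain C where C: "\<forall>g\<in>{g \<in> Lip0 M z. Lip_norm M g \<le> 1}. norm (\<phi> g) \<le> C"
    using dual_norm_bdd[OF assms(1)] by blast
  obtain D where D: "\<forall>g\<in>{g \<in> Lip0 M z. Lip_norm M g \<le> 1}. norm (\<psi> g) \<le> D"
    using dual_norm_bdd[OF assms(2)] by blast
  have "norm (\<phi> g - \<psi> g) \<le> C + D" if "g \<in> {g \<in> Lip0 M z. Lip_norm M g \<le> 1}" for g
    using C D that norm_triangle_ineq4[of "\<phi> g" "\<psi> g"] by fastforce
  then show ?thesis
    by (rule bdd_aboveI2)
qed

lemma unit_ball_nonempty: "(\<lambda>x. 0) \<in> {g \<in> Lip0 M z. Lip_norm M g \<le> 1}"
  using Lip_norm_le[of 1 M "\<lambda>x. 0"] by (simp add: zero_in_Lip0)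

lemma dual_dist_upper:
  assumes "\<phi> \<in> Lip0_dual M z" "\<psi> \<in> Lip0_dual M z" "g \<in> Lip0 M z" "Lip_norm M g \<le> 1"
  shows "norm (\<phi> g - \<psi> g) \<le> dual_dist M z \<phi> \<psi>"
proof -
  have "g \<in> {g \<in> Lip0 M z. Lip_norm M g \<le> 1}"
    using assms(3,4) by blast
  from cSUP_upper[OF this dual_dist_bdd[OF assms(1,2)]] show ?thesis
    using assms(1,2) by (simp only: dual_dist_def dual_norm_def simp_thms if_True)
qed

lemma dual_dist_least:
  fixes \<phi> \<psi> :: "('a \<Rightarrow> 'k::real_normed_field) \<Rightarrow> 'k"
  assumes "\<phi> \<in> Lip0_dual M z" "\<psi> \<in> Lip0_dual M z"
    and *: "\<And>g. g \<in> Lip0 M z \<Longrightarrow> Lip_norm M g \<le> 1 \<Longrightarrow> norm (\<phi> g - \<psi> g) \<le> C"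
  shows "dual_dist M z \<phi> \<psi> \<le> C"
proof -
  have "{g \<in> Lip0 M z. Lip_norm M g \<le> 1} \<noteq> ({} :: ('a \<Rightarrow> 'k) set)"
    by (rule ex_in_conv[THEN iffD1, OF exI, OF unit_ball_nonempty])
  then have "(SUP g\<in>{g \<in> Lip0 M z. Lip_norm M g \<le> 1}. norm (\<phi> g - \<psi> g)) \<le> C"
    by (rule cSUP_least) (simp add: *)
  then show ?thesis
    using assms(1,2) by (simp only: dual_dist_def dual_norm_def simp_thms if_True)
qed

lemma Metric_space_dual: "Metric_space (Lip0_dual M z) (dual_dist M z)"
proof
  fix \<phi> \<psi> :: "('a \<Rightarrow> 'k::real_normed_field) \<Rightarrow> 'k"
  show "0 \<le> dual_dist M z \<phi> \<psi>"
  proof (cases "\<phi> \<in> Lip0_dual M z \<and> \<psi> \<in> Lip0_dual M z")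
    case True
    have "0 \<le> norm (\<phi> (\<lambda>x. 0) - \<psi> (\<lambda>x. 0))" by simp
    also have "\<dots> \<le> dual_dist M z \<phi> \<psi>"
      using True unit_ball_nonempty[of M z] by (intro dual_dist_upper) auto
    finally show ?thesis .
  qed (auto simp: dual_dist_def)
  show "dual_dist M z \<phi> \<psi> = dual_dist M z \<psi> \<phi>"
    by (auto simp: dual_dist_def dual_norm_def norm_minus_commute)
next
  fix \<phi> \<psi> :: "('a \<Rightarrow> 'k::real_normed_field) \<Rightarrow> 'k"
  assume mem: "\<phi> \<in> Lip0_dual M z" "\<psi> \<in> Lip0_dual M z"
  show "dual_dist M z \<phi> \<psi> = 0 \<longleftrightarrow> \<phi> = \<psi>"
  proof
    assume 0: "dual_dist M z \<phi> \<psi> = 0"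
    have "\<phi> g = \<psi> g" for g
    proof (cases "g \<in> Lip0 M z")
      case g: True
      define L where "L = Lip_norm M g"
      define c :: 'k where "c = of_real (1 / (1 + L))"
      have L: "L \<ge> 0" using Lip_norm_nonneg[OF g] by (simp add: L_def)
      have c: "norm c = 1 / (1 + L)" "c \<noteq> 0"
        using L unfolding c_def norm_of_real of_real_eq_0_iff by auto
      have "Lip_norm M (\<lambda>x. c * g x) \<le> 1"
      proof (rule Lip_norm_le)
        fix x y assume xy: "x \<in> mspace M" "y \<in> mspace M"
        have "norm (c * g x - c * g y) = norm c * norm (g x - g y)"
          by (simp add: norm_mult flip: right_diff_distrib)
        also have "\<dots> \<le> norm c * (L * mdist M x y)"
          using Lip_norm_bound[OF g xy] by (intro mult_left_mono) (auto simp: L_def)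
        also have "\<dots> = (L / (1 + L)) * mdist M x y"
          by (simp add: c)
        also have "\<dots> \<le> 1 * mdist M x y"
          using L by (intro mult_right_mono) auto
        finally show "norm (c * g x - c * g y) \<le> 1 * mdist M x y" .
      qed simp
      then have "norm (\<phi> (\<lambda>x. c * g x) - \<psi> (\<lambda>x. c * g x)) \<le> 0"
        using dual_dist_upper[OF mem scale_in_Lip0[OF g, of c]] 0 by simp
      moreover have "\<phi> (\<lambda>x. c * g x) = c * \<phi> g" "\<psi> (\<lambda>x. c * g x) = c * \<psi> g"
        using mem g by (auto simp: Lip0_dual_def)
      ultimately show ?thesis using c by simp
    qed (use mem in \<open>auto simp: Lip0_dual_def\<close>)
    then show "\<phi> = \<psi>" by blast
  next
    assume eq: "\<phi> = \<psi>"
    have le: "dual_dist M z \<psi> \<psi> \<le> 0"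
      by (rule dual_dist_least) (use mem in auto)
    have "norm (\<psi> (\<lambda>x. 0) - \<psi> (\<lambda>x. 0)) \<le> dual_dist M z \<psi> \<psi>"
      using mem unit_ball_nonempty[of M z] by (intro dual_dist_upper) auto
    then have "0 \<le> dual_dist M z \<psi> \<psi>"
      by (rule order_trans[OF norm_ge_zero])
    with le show "dual_dist M z \<phi> \<psi> = 0"
      unfolding eq by (rule order_antisym)
  qed
next
  fix \<phi> \<psi> \<rho> :: "('a \<Rightarrow> 'k::real_normed_field) \<Rightarrow> 'k"
  assume mem: "\<phi> \<in> Lip0_dual M z" "\<psi> \<in> Lip0_dual M z" "\<rho> \<in> Lip0_dual M z"
  show "dual_dist M z \<phi> \<rho> \<le> dual_dist M z \<phi> \<psi> + dual_dist M z \<psi> \<rho>"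
  proof (rule dual_dist_least)
    fix g :: "'a \<Rightarrow> 'k" assume g: "g \<in> Lip0 M z" "Lip_norm M g \<le> 1"
    have "norm (\<phi> g - \<rho> g) \<le> norm (\<phi> g - \<psi> g) + norm (\<psi> g - \<rho> g)"
      using norm_triangle_ineq[of "\<phi> g - \<psi> g" "\<psi> g - \<rho> g"] by simp
    also have "\<dots> \<le> dual_dist M z \<phi> \<psi> + dual_dist M z \<psi> \<rho>"
      using mem g by (intro add_mono dual_dist_upper) auto
    finally show "norm (\<phi> g - \<rho> g) \<le> dual_dist M z \<phi> \<psi> + dual_dist M z \<psi> \<rho>" .
  qed (use mem in auto)
qed

lemma mspace_dual_metric [simp]: "mspace (dual_metric M z) = Lip0_dual M z"
  and mdist_dual_metric [simp]: "mdist (dual_metric M z) = dual_dist M z"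
  unfolding dual_metric_def
  by (rule Metric_space.mspace_metric[OF Metric_space_dual]
      Metric_space.mdist_metric[OF Metric_space_dual])+

lemma Lip0_add:
  assumes g: "g \<in> Lip0 M z" and h: "h \<in> Lip0 M z"
  shows "(\<lambda>x. g x + h x) \<in> Lip0 M z"
proof -
  have "dist (g x + h x) (g y + h y) \<le> (Lip_norm M g + Lip_norm M h) * mdist M x y"
    if "x \<in> mspace M" "y \<in> mspace M" for x y
    using Lip_norm_bound[OF g that] Lip_norm_bound[OF h that]
      norm_triangle_ineq[of "g x - g y" "h x - h y"]
    by (simp add: dist_norm algebra_simps)
  then show ?thesis
    using g h unfolding Lip0_def Lipschitz_continuous_map_def by auto
qed

lemma delta_span_subset_dual:
  assumes z: "z \<in> mspace M"
  shows "delta_span M z \<subseteq> Lip0_dual M z"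
proof
  fix \<phi> :: "('a \<Rightarrow> 'k::real_normed_field) \<Rightarrow> 'k"
  assume "\<phi> \<in> delta_span M z"
  then obtain A c where A: "finite A" "A \<subseteq> mspace M"
    and \<phi>: "\<phi> = (\<lambda>g. \<Sum>x\<in>A. c x * delta M z x g)"
    unfolding delta_span_def by blast
  have "norm (\<phi> g) \<le> (\<Sum>x\<in>A. norm (c x) * mdist M x z) * Lip_norm M g" if g: "g \<in> Lip0 M z" for g
  proof -
    have "norm (\<phi> g) \<le> (\<Sum>x\<in>A. norm (c x * g x))"
      using g by (simp add: \<phi> delta_def norm_sum)
    also have "\<dots> \<le> (\<Sum>x\<in>A. norm (c x) * (Lip_norm M g * mdist M x z))"
    proof (rule sum_mono)
      fix x assume "x \<in> A"
      then have "norm (g x) \<le> Lip_norm M g * mdist M x z"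
        using Lip_norm_bound[OF g, of x z] z A g by (auto simp: Lip0_def)
      then show "norm (c x * g x) \<le> norm (c x) * (Lip_norm M g * mdist M x z)"
        by (simp add: norm_mult mult_left_mono)
    qed
    also have "\<dots> = (\<Sum>x\<in>A. norm (c x) * mdist M x z) * Lip_norm M g"
      unfolding sum_distrib_right by (intro sum.cong) (simp_all add: mult_ac)
    finally show ?thesis .
  qed
  then have "\<exists>K. \<forall>g\<in>Lip0 M z. norm (\<phi> g) \<le> K * Lip_norm M g"
    by blast
  moreover have "\<phi> (\<lambda>x. g x + h x) = \<phi> g + \<phi> h" if "g \<in> Lip0 M z" "h \<in> Lip0 M z" for g h
    using that Lip0_add[OF that] by (simp add: \<phi> delta_def algebra_simps sum.distrib)
  moreover have "\<phi> (\<lambda>x. a * g x) = a * \<phi> g" if "g \<in> Lip0 M z" for a g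
    using that scale_in_Lip0[OF that, of a] by (simp add: \<phi> delta_def sum_distrib_left mult_ac)
  moreover have "\<phi> g = 0" if "g \<notin> Lip0 M z" for g
    using that by (simp add: \<phi> delta_def)
  ultimately show "\<phi> \<in> Lip0_dual M z"
    unfolding Lip0_dual_def by blast
qed

lemma mu_in_free_space:
  assumes z: "z \<in> mspace M" and x: "x \<in> mspace M"
  shows "mu \<alpha> M z x \<in> mspace (free_space M z)"
proof -
  have "mu \<alpha> M z x \<in> delta_span M z"
  proof (cases "x = z")
    case True
    then show ?thesis
      unfolding delta_span_def mu_def by (auto intro!: exI[of _ "{}"])
  next
    case False
    then show ?thesis
      unfolding delta_span_def mu_def using x
      by (auto intro!: exI[of _ "{x}"] exI[of _ "\<lambda>y. 1 / of_real (\<alpha> (mdist M z y))"])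
  qed
  moreover have "delta_span M z \<subseteq> mtopology_of (dual_metric M z) closure_of delta_span M z"
    using delta_span_subset_dual[OF z] by (intro closure_of_subset) simp
  ultimately show ?thesis
    using delta_span_subset_dual[OF z] by (auto simp: free_space_def)
qed

lemma mspace_B_space:
  assumes "z \<in> mspace M"
  shows "mspace (B_space \<alpha> M z) = mu \<alpha> M z ` mspace M"
  unfolding B_space_def mspace_submetric
  using mu_in_free_space[OF assms] by (intro Int_absorb2 image_subsetI)

lemma mdist_B_space [simp]: "mdist (B_space \<alpha> M z) = dual_dist M z"
  by (simp only: B_space_def free_space_def mdist_submetric mdist_dual_metric)

lemma pointed_metric_B_space:
  assumes "pointed_metric M z"
  shows "pointed_metric (B_space \<alpha> M z) (\<lambda>g. 0)"
proof -
  have z: "z \<in> mspace M"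
    using assms by (simp add: pointed_metric_def)
  have "mu \<alpha> M z z \<in> mspace (B_space \<alpha> M z)"
    unfolding mspace_B_space[OF z] using z by (rule imageI)
  then show ?thesis
    by (simp add: pointed_metric_def mu_def)
qed

end

theory Submission
  imports Defs
begin

text \<open>
  Everything follows from a formula for the metric of \<open>\<B>(M)\<close> up to constants.  Write
  \<open>|x| = d(0,x)\<close>, let \<open>L\<close> be a Lipschitz constant of \<open>\<alpha>\<close> and let \<open>t \<le> D \<alpha>(t)\<close> for all
  \<open>t > 0\<close>.  For distinct points with \<open>|y| \<le> |x|\<close>,

    \<open>d(x,y) / (2 \<alpha>(|x|)) \<le> \<parallel>\<mu>(x) - \<mu>(y)\<parallel> \<le> (1 + L D) d(x,y) / \<alpha>(|x|)\<close>.

  The lower bound comes from evaluating at a tent function that peaks at \<open>x\<close> and vanishes at both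
  \<open>0\<close> and \<open>y\<close> (\<open>mu_dist_lower\<close>); the upper bound writes \<open>\<mu>(x) - \<mu>(y)\<close> as
  \<open>(\<delta>(x) - \<delta>(y)) / \<alpha>(|x|)\<close> plus an error that is small because \<open>\<alpha>\<close> is Lipschitz
  (\<open>mu_dist_upper\<close>).

  In particular \<open>\<mu>\<close> is injective, so \<open>\<B>(f)\<close> does send \<open>\<mu>(x)\<close> to \<open>\<mu>(f(x))\<close> and functoriality is
  immediate.  A bi-Lipschitz zero-preserving \<open>f\<close> changes both \<open>d(x,y)\<close> and \<open>max(|x|,|y|)\<close> by
  bounded factors only, and changing the argument of \<open>\<alpha>\<close> by a bounded factor changes its value by
  a bounded factor (\<open>weight_quasi_monotone\<close>).  Hence the formula above, applied in \<open>M\<close> and in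
  \<open>N\<close>, shows that \<open>\<B>(f)\<close> is bi-Lipschitz.
\<close>

section \<open>Tent functions and normalized evaluations\<close>

text \<open>The real tent is transported into the scalar field, since the test functions of the dual norm
  take their values there.\<close>

definition tent :: "'a metric \<Rightarrow> 'a \<Rightarrow> real \<Rightarrow> 'a \<Rightarrow> 'k::real_normed_field" where
  "tent M x \<rho> = (\<lambda>w. if w \<in> mspace M then of_real (max 0 (\<rho> - mdist M x w)) else 0)"

lemma norm_tent_diff_le:
  assumes "x \<in> mspace M" "v \<in> mspace M" "w \<in> mspace M"
  shows "norm (tent M x \<rho> v - tent M x \<rho> w :: 'k::real_normed_field) \<le> mdist M v w"
proof -
  have "\<bar>mdist M x v - mdist M x w\<bar> \<le> mdist M v w"
    using mdist_triangle[of x M v w] mdist_triangle[of x M w v] assms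
    by (simp add: mdist_commute[of M w v])
  then have "\<bar>max 0 (\<rho> - mdist M x v) - max 0 (\<rho> - mdist M x w)\<bar> \<le> mdist M v w"
    by linarith
  then show ?thesis
    using assms by (simp add: tent_def flip: of_real_diff)
qed

lemma tent_in_unit_ball:
  assumes "x \<in> mspace M" "z \<in> mspace M" "\<rho> \<le> mdist M x z"
  shows "(tent M x \<rho> :: 'a \<Rightarrow> 'k::real_normed_field) \<in> Lip0 M z"
    and "Lip_norm M (tent M x \<rho> :: 'a \<Rightarrow> 'k) \<le> 1"
proof -
  have "Lipschitz_continuous_map M euclidean_metric (tent M x \<rho> :: 'a \<Rightarrow> 'k)"
    unfolding Lipschitz_continuous_map_def
    using norm_tent_diff_le[OF assms(1)] by (auto simp: dist_norm intro!: exI[of _ 1])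
  then show "(tent M x \<rho> :: 'a \<Rightarrow> 'k) \<in> Lip0 M z"
    using assms by (simp add: Lip0_def tent_def)
  show "Lip_norm M (tent M x \<rho> :: 'a \<Rightarrow> 'k) \<le> 1"
    using norm_tent_diff_le[OF assms(1)] by (intro Lip_norm_le) auto
qed

lemma mu_base_point: "mu \<alpha> M z z = (\<lambda>g. 0)"
  by (simp add: mu_def)

text \<open>On \<open>Lip0\<close> the case distinction in the definition of \<open>\<mu>\<close> disappears, whatever the value of
  \<open>\<alpha>\<close> at \<open>0\<close> is, because the test functions vanish at the base point.\<close>

lemma mu_apply:
  assumes "g \<in> Lip0 M z"
  shows "mu \<alpha> M z x g = g x / of_real (\<alpha> (mdist M z x))"
  using assms by (auto simp: mu_def delta_def Lip0_def)

lemma mu_in_dual: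
  fixes M :: "'a metric"
  assumes "z \<in> mspace M" "x \<in> mspace M"
  shows "(mu \<alpha> M z x :: ('a \<Rightarrow> 'k::real_normed_field) \<Rightarrow> 'k) \<in> Lip0_dual M z"
proof -
  have "(mu \<alpha> M z x :: ('a \<Rightarrow> 'k) \<Rightarrow> 'k) \<in> mspace (free_space M z)"
    by (rule mu_in_free_space[OF assms])
  then show ?thesis
    by (simp add: free_space_def)
qed

section \<open>Lipschitz weights of at least linear growth\<close>

locale lipschitz_weight =
  fixes \<alpha> :: "real \<Rightarrow> real" and L D :: real
  assumes weight_pos: "0 < t \<Longrightarrow> 0 < \<alpha> t"
    and weight_lipschitz: "L-lipschitz_on {0<..} \<alpha>"
    and linear_growth: "0 < t \<Longrightarrow> t \<le> D * \<alpha> t"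
begin

lemma L_nonneg: "0 \<le> L"
  using weight_lipschitz by (rule lipschitz_on_nonneg)

lemma D_nonneg: "0 \<le> D"
proof -
  have "0 < D * \<alpha> 1"
    using linear_growth[of 1] by simp
  then show ?thesis
    using weight_pos[of 1] by (simp add: zero_less_mult_iff)
qed

lemma weight_diff_le:
  assumes "0 < t" "0 < u"
  shows "\<bar>\<alpha> t - \<alpha> u\<bar> \<le> L * \<bar>t - u\<bar>"
  using lipschitz_onD[OF weight_lipschitz, of t u] assms by (simp add: dist_real_def)

text \<open>The increment \<open>L |t - u|\<close> is at most \<open>L (1 + c) u\<close>, and \<open>u\<close> itself is dominated by the
  weight at \<open>u\<close>.\<close>

lemma weight_quasi_monotone:
  assumes "0 < t" "0 < u" "0 \<le> c" "t \<le> c * u"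
  shows "\<alpha> t \<le> (1 + L * (1 + c) * D) * \<alpha> u"
proof -
  have "\<alpha> t \<le> \<alpha> u + L * \<bar>t - u\<bar>"
    using weight_diff_le[OF assms(1,2)] by linarith
  also have "L * \<bar>t - u\<bar> \<le> L * ((1 + c) * u)"
    using assms by (intro mult_left_mono[OF _ L_nonneg]) (auto simp: algebra_simps)
  also have "\<dots> \<le> L * ((1 + c) * (D * \<alpha> u))"
    using assms linear_growth[of u] L_nonneg by (intro mult_left_mono) auto
  finally show ?thesis
    by (simp add: algebra_simps)
qed

section \<open>The metric of the image of \<mu> up to constants\<close>

text \<open>A functional of the unit ball sees \<open>\<mu>(x) - \<mu>(y)\<close> as
  \<open>(g(x) - g(y)) / \<alpha>(|x|) + g(y) (1 / \<alpha>(|x|) - 1 / \<alpha>(|y|))\<close>.  Since \<open>|g(y)| \<le> |y| \<le> D \<alpha>(|y|)\<close>,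
  the factor \<open>\<alpha>(|y|)\<close> in the second denominator cancels, leaving \<open>L D d(x,y) / \<alpha>(|x|)\<close>.\<close>

lemma mu_dist_upper:
  fixes M :: "'a metric"
  assumes z: "z \<in> mspace M" and x: "x \<in> mspace M" and y: "y \<in> mspace M" and "x \<noteq> z"
  shows "dual_dist M z (mu \<alpha> M z x :: ('a \<Rightarrow> 'k::real_normed_field) \<Rightarrow> 'k) (mu \<alpha> M z y)
    \<le> (1 + L * D) * mdist M x y / \<alpha> (mdist M z x)"
proof (rule dual_dist_least)
  fix g :: "'a \<Rightarrow> 'k"
  assume g: "g \<in> Lip0 M z" "Lip_norm M g \<le> 1"
  define a b s where "a = \<alpha> (mdist M z x)" and "b = \<alpha> (mdist M z y)" and "s = mdist M z y"
  have r: "0 < mdist M z x"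
    using z x \<open>x \<noteq> z\<close> by (simp add: less_le)
  have a: "0 < a"
    using weight_pos[OF r] by (simp add: a_def)
  have contr: "norm (g v - g w) \<le> mdist M v w" if "v \<in> mspace M" "w \<in> mspace M" for v w
    using Lip_norm_bound[OF g(1) that] mult_right_mono[OF g(2), of "mdist M v w"] by simp
  have gy: "norm (g y) \<le> s"
    using contr[OF y z] g(1) by (simp add: Lip0_def s_def mdist_commute)
  have eq: "g x / of_real a - g y / of_real b
      = (g x - g y) / of_real a + g y * of_real (1 / a - 1 / b)"
    by (simp add: diff_divide_distrib right_diff_distrib)
  have second: "norm (g y) * \<bar>1 / a - 1 / b\<bar> \<le> L * D * mdist M x y / a"
  proof (cases "y = z")
    case True
    then show ?thesis
      using g(1) a L_nonneg D_nonneg by (simp add: Lip0_def)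
  next
    case False
    then have s: "0 < s"
      using z y by (simp add: s_def less_le)
    have b: "0 < b"
      using weight_pos[OF s] by (simp add: b_def s_def)
    have "\<bar>b - a\<bar> \<le> L * \<bar>s - mdist M z x\<bar>"
      using weight_diff_le[OF s r] by (simp add: a_def b_def s_def)
    also have "\<dots> \<le> L * mdist M x y"
      using mdist_triangle[OF z x y] mdist_triangle[OF z y x]
      by (intro mult_left_mono[OF _ L_nonneg]) (simp add: s_def mdist_commute[of M y x] abs_le_iff)
    finally have ab: "\<bar>b - a\<bar> \<le> L * mdist M x y" .
    have "norm (g y) \<le> D * b"
      using gy linear_growth[OF s] by (simp add: b_def s_def)
    then have "norm (g y) * \<bar>b - a\<bar> \<le> (D * b) * (L * mdist M x y)"
      using ab D_nonneg b by (intro mult_mono) auto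
    then have "norm (g y) * \<bar>b - a\<bar> / (a * b) \<le> (D * b) * (L * mdist M x y) / (a * b)"
      using a b by (intro divide_right_mono) auto
    moreover have "\<bar>1 / a - 1 / b\<bar> = \<bar>b - a\<bar> / (a * b)"
      using a b by (simp add: diff_frac_eq abs_mult)
    ultimately show ?thesis
      using a b by (simp add: mult_ac)
  qed
  have "norm (mu \<alpha> M z x g - mu \<alpha> M z y g) = norm (g x / of_real a - g y / of_real b)"
    using g(1) by (simp add: mu_apply a_def b_def)
  also have "\<dots> \<le> norm ((g x - g y) / (of_real a :: 'k)) + norm (g y * of_real (1 / a - 1 / b))"
    unfolding eq by (rule norm_triangle_ineq)
  also have "norm ((g x - g y) / (of_real a :: 'k)) = norm (g x - g y) / a"
    using a by (simp add: norm_divide)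
  also have "norm (g y * of_real (1 / a - 1 / b)) = norm (g y) * \<bar>1 / a - 1 / b\<bar>"
    by (simp only: norm_mult norm_of_real)
  also have "norm (g x - g y) / a + norm (g y) * \<bar>1 / a - 1 / b\<bar>
      \<le> mdist M x y / a + L * D * mdist M x y / a"
    using contr[OF x y] second a by (intro add_mono divide_right_mono) auto
  finally show "norm (mu \<alpha> M z x g - mu \<alpha> M z y g)
      \<le> (1 + L * D) * mdist M x y / \<alpha> (mdist M z x)"
    by (simp add: a_def add_divide_distrib algebra_simps)
qed (simp_all add: mu_in_dual z x y)

text \<open>The tent of height \<open>d(x,y) / 2\<close> at the farther point \<open>x\<close> vanishes at \<open>0\<close>, as
  \<open>d(x,y) \<le> |x| + |y| \<le> 2 |x|\<close>, and it vanishes at \<open>y\<close>.\<close>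

lemma mu_dist_lower:
  fixes M :: "'a metric"
  assumes z: "z \<in> mspace M" and x: "x \<in> mspace M" and y: "y \<in> mspace M" and "x \<noteq> z"
    and far: "mdist M z y \<le> mdist M z x"
  shows "mdist M x y / (2 * \<alpha> (mdist M z x))
    \<le> dual_dist M z (mu \<alpha> M z x :: ('a \<Rightarrow> 'k::real_normed_field) \<Rightarrow> 'k) (mu \<alpha> M z y)"
proof -
  define h :: "'a \<Rightarrow> 'k" where "h = tent M x (mdist M x y / 2)"
  have "mdist M x y / 2 \<le> mdist M x z"
    using mdist_triangle[OF x z y] far by (simp add: mdist_commute[of M x z])
  then have h: "h \<in> Lip0 M z" "Lip_norm M h \<le> 1"
    unfolding h_def by (rule tent_in_unit_ball[OF x z])+
  have "0 < mdist M z x"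
    using z x \<open>x \<noteq> z\<close> by (simp add: less_le)
  then have a: "0 < \<alpha> (mdist M z x)"
    by (rule weight_pos)
  have xx: "mdist M x x = 0"
    using x by simp
  have hx: "h x = of_real (mdist M x y / 2)"
    using x by (simp add: h_def tent_def xx del: mdist_zero)
  have hy: "h y = 0"
    using y by (simp add: h_def tent_def)
  have "norm (mu \<alpha> M z x h - mu \<alpha> M z y h)
      = norm (of_real (mdist M x y / 2 / \<alpha> (mdist M z x)) :: 'k)"
    using h(1) by (simp add: mu_apply hx hy)
  also have "\<dots> = mdist M x y / (2 * \<alpha> (mdist M z x))"
    unfolding norm_of_real using a by simp
  finally have "mdist M x y / (2 * \<alpha> (mdist M z x))
      = norm (mu \<alpha> M z x h - mu \<alpha> M z y h)" ..
  also have "\<dots> \<le> dual_dist M z (mu \<alpha> M z x :: ('a \<Rightarrow> 'k) \<Rightarrow> 'k) (mu \<alpha> M z y)"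
    by (rule dual_dist_upper[OF mu_in_dual[OF z x] mu_in_dual[OF z y] h])
  finally show ?thesis .
qed

text \<open>Both sides of the estimate, symmetrized: the weight is taken at whichever point is farther from
  the base point.\<close>

lemma mu_dist_bounds:
  fixes M :: "'a metric"
  assumes z: "z \<in> mspace M" and x: "x \<in> mspace M" and y: "y \<in> mspace M" and "x \<noteq> y"
  defines "R \<equiv> max (mdist M z x) (mdist M z y)"
  shows "0 < R"
    and "mdist M x y / (2 * \<alpha> R)
      \<le> dual_dist M z (mu \<alpha> M z x :: ('a \<Rightarrow> 'k::real_normed_field) \<Rightarrow> 'k) (mu \<alpha> M z y)"
    and "dual_dist M z (mu \<alpha> M z x :: ('a \<Rightarrow> 'k::real_normed_field) \<Rightarrow> 'k) (mu \<alpha> M z y)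
      \<le> (1 + L * D) * mdist M x y / \<alpha> R"
proof -
  have pos: "0 < mdist M z w \<longleftrightarrow> w \<noteq> z" if "w \<in> mspace M" for w
    using z that by (auto simp: less_le)
  show "0 < R"
    using pos[OF x] pos[OF y] \<open>x \<noteq> y\<close> by (auto simp: R_def less_max_iff_disj)
  have comm: "dual_dist M z (mu \<alpha> M z x :: ('a \<Rightarrow> 'k) \<Rightarrow> 'k) (mu \<alpha> M z y)
      = dual_dist M z (mu \<alpha> M z y :: ('a \<Rightarrow> 'k) \<Rightarrow> 'k) (mu \<alpha> M z x)"
    by (rule Metric_space.commute[OF Metric_space_dual])
  consider "mdist M z y \<le> mdist M z x" "R = mdist M z x" "x \<noteq> z"
    | "mdist M z x \<le> mdist M z y" "R = mdist M z y" "y \<noteq> z"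
    using \<open>0 < R\<close> pos[OF x] pos[OF y] by (auto simp: R_def max_def split: if_splits)
  then have "mdist M x y / (2 * \<alpha> R)
        \<le> dual_dist M z (mu \<alpha> M z x :: ('a \<Rightarrow> 'k) \<Rightarrow> 'k) (mu \<alpha> M z y) \<and>
      dual_dist M z (mu \<alpha> M z x :: ('a \<Rightarrow> 'k) \<Rightarrow> 'k) (mu \<alpha> M z y)
        \<le> (1 + L * D) * mdist M x y / \<alpha> R"
  proof cases
    case 1
    then show ?thesis
      using mu_dist_lower[OF z x y] mu_dist_upper[OF z x y] by simp
  next
    case 2
    then show ?thesis
      using mu_dist_lower[OF z y x] mu_dist_upper[OF z y x] comm
      by (simp add: mdist_commute[of M y x])
  qed
  then show "mdist M x y / (2 * \<alpha> R)
      \<le> dual_dist M z (mu \<alpha> M z x :: ('a \<Rightarrow> 'k::real_normed_field) \<Rightarrow> 'k) (mu \<alpha> M z y)"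
    and "dual_dist M z (mu \<alpha> M z x :: ('a \<Rightarrow> 'k::real_normed_field) \<Rightarrow> 'k) (mu \<alpha> M z y)
      \<le> (1 + L * D) * mdist M x y / \<alpha> R"
    by blast+
qed

lemma mu_dist_self:
  fixes M :: "'a metric"
  assumes "z \<in> mspace M" "x \<in> mspace M"
  shows "dual_dist M z (mu \<alpha> M z x :: ('a \<Rightarrow> 'k::real_normed_field) \<Rightarrow> 'k) (mu \<alpha> M z x) = 0"
  by (rule Metric_space.mdist_zero[OF Metric_space_dual mu_in_dual[OF assms]])

lemma inj_on_mu:
  fixes M :: "'a metric"
  assumes z: "z \<in> mspace M"
  shows "inj_on (mu \<alpha> M z :: 'a \<Rightarrow> ('a \<Rightarrow> 'k::real_normed_field) \<Rightarrow> 'k) (mspace M)"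
proof (rule inj_onI, rule ccontr)
  fix x y
  assume x: "x \<in> mspace M" and y: "y \<in> mspace M"
    and eq: "(mu \<alpha> M z x :: ('a \<Rightarrow> 'k) \<Rightarrow> 'k) = mu \<alpha> M z y" and "x \<noteq> y"
  let ?R = "max (mdist M z x) (mdist M z y)"
  have "0 < mdist M x y / (2 * \<alpha> ?R)"
    using x y \<open>x \<noteq> y\<close> weight_pos[OF mu_dist_bounds(1)[OF z x y \<open>x \<noteq> y\<close>]] by (simp add: less_le)
  also have "\<dots> \<le> dual_dist M z (mu \<alpha> M z x :: ('a \<Rightarrow> 'k) \<Rightarrow> 'k) (mu \<alpha> M z y)"
    by (rule mu_dist_bounds(2)[OF z x y \<open>x \<noteq> y\<close>])
  finally show False
    by (simp add: eq mu_dist_self[OF z y])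
qed

lemma B_map_mu:
  fixes M :: "'a metric"
  assumes "z \<in> mspace M" "x \<in> mspace M"
  shows "B_map \<alpha> M z N z' f (mu \<alpha> M z x :: ('a \<Rightarrow> 'k::real_normed_field) \<Rightarrow> 'k)
    = mu \<alpha> N z' (f x)"
  by (simp add: B_map_def inv_into_f_f[OF inj_on_mu[OF assms(1)] assms(2)])

section \<open>Distortion under bi-Lipschitz maps\<close>

text \<open>If \<open>R\<close> and \<open>R'\<close> are the larger distances to the base point before and after applying \<open>f\<close>,
  then \<open>a R \<le> R' \<le> b R\<close>, even when \<open>f\<close> exchanges which of the two points is farther.  So the
  weights at \<open>R\<close> and \<open>R'\<close> are comparable, and the estimates for \<open>\<mu>\<close> in \<open>M\<close> and \<open>N\<close> combine.\<close>

lemma mu_dist_distortion: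
  fixes M :: "'a metric" and N :: "'b metric"
  assumes f: "f \<in> mspace M \<rightarrow> mspace N" and z: "z \<in> mspace M"
    and ab: "0 < a" "a \<le> b"
    and lower: "\<And>x y. x \<in> mspace M \<Longrightarrow> y \<in> mspace M \<Longrightarrow> a * mdist M x y \<le> mdist N (f x) (f y)"
    and upper: "\<And>x y. x \<in> mspace M \<Longrightarrow> y \<in> mspace M \<Longrightarrow> mdist N (f x) (f y) \<le> b * mdist M x y"
  shows "\<exists>A B. 0 < A \<and> A \<le> B \<and> (\<forall>x\<in>mspace M. \<forall>y\<in>mspace M.
      A * dual_dist M z (mu \<alpha> M z x :: ('a \<Rightarrow> 'k::real_normed_field) \<Rightarrow> 'k) (mu \<alpha> M z y)
        \<le> dual_dist N (f z) (mu \<alpha> N (f z) (f x) :: ('b \<Rightarrow> 'k) \<Rightarrow> 'k) (mu \<alpha> N (f z) (f y)) \<and>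
      dual_dist N (f z) (mu \<alpha> N (f z) (f x) :: ('b \<Rightarrow> 'k) \<Rightarrow> 'k) (mu \<alpha> N (f z) (f y))
        \<le> B * dual_dist M z (mu \<alpha> M z x :: ('a \<Rightarrow> 'k) \<Rightarrow> 'k) (mu \<alpha> M z y))"
proof -
  let ?dM = "\<lambda>x y. dual_dist M z (mu \<alpha> M z x :: ('a \<Rightarrow> 'k) \<Rightarrow> 'k) (mu \<alpha> M z y)"
  let ?dN = "\<lambda>x y. dual_dist N (f z) (mu \<alpha> N (f z) (f x) :: ('b \<Rightarrow> 'k) \<Rightarrow> 'k)
    (mu \<alpha> N (f z) (f y))"
  \<comment> \<open>\<open>C1\<close> and \<open>C2\<close> are the constants of \<open>weight_quasi_monotone\<close> for \<open>R \<le> R' / a\<close> and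
    \<open>R' \<le> b R\<close>.\<close>
  define E C1 C2 where "E = 1 + L * D" and "C1 = 1 + L * (1 + 1 / a) * D"
    and "C2 = 1 + L * (1 + b) * D"
  define A B where "A = a / (2 * C2 * E)" and "B = 2 * E * b * C1"
  have E: "1 \<le> E" and C1: "1 \<le> C1" and C2: "1 \<le> C2"
    using L_nonneg D_nonneg ab by (auto simp: E_def C1_def C2_def)
  have A: "0 < A"
    using ab E C2 by (simp add: A_def)
  have bounds: "A * ?dM x y \<le> ?dN x y" "?dN x y \<le> B * ?dM x y"
    if x: "x \<in> mspace M" and y: "y \<in> mspace M" and "x \<noteq> y" for x y
  proof -
    define d d' where "d = mdist M x y" and "d' = mdist N (f x) (f y)"
    define R R' where "R = max (mdist M z x) (mdist M z y)"
      and "R' = max (mdist N (f z) (f x)) (mdist N (f z) (f y))"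
    have fM: "f z \<in> mspace N" "f x \<in> mspace N" "f y \<in> mspace N"
      using f z x y by auto
    have dpos: "0 < d"
      using x y \<open>x \<noteq> y\<close> by (simp add: d_def less_le)
    have dd: "a * d \<le> d'" "d' \<le> b * d"
      using lower[OF x y] upper[OF x y] by (simp_all add: d_def d'_def)
    have d'pos: "0 < d'"
      using dd(1) mult_pos_pos[OF ab(1) dpos] by linarith
    then have "f x \<noteq> f y"
      using mdist_zero[OF fM(2,3)] by (simp add: d'_def)
    note boundM = mu_dist_bounds[OF z x y \<open>x \<noteq> y\<close>, folded R_def d_def]
    note boundN = mu_dist_bounds[OF fM \<open>f x \<noteq> f y\<close>, folded R'_def d'_def]
    have aR: "0 < \<alpha> R" and aR': "0 < \<alpha> R'"
      using weight_pos boundM(1) boundN(1) by auto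
    have "a * R \<le> R'"
      using lower[OF z x] lower[OF z y] by (auto simp: R_def R'_def max_def)
    then have "R \<le> 1 / a * R'"
      using ab by (simp add: field_simps)
    then have w1: "\<alpha> R \<le> C1 * \<alpha> R'"
      unfolding C1_def using boundM(1) boundN(1) ab by (intro weight_quasi_monotone) auto
    have bmono: "b * mdist M z x \<le> b * R" "b * mdist M z y \<le> b * R"
      using ab by (auto simp: R_def)
    have "R' \<le> b * R"
      using upper[OF z x] upper[OF z y] bmono by (auto simp: R'_def)
    then have w2: "\<alpha> R' \<le> C2 * \<alpha> R"
      unfolding C2_def using boundM(1) boundN(1) ab by (intro weight_quasi_monotone) auto
    have "?dN x y \<le> E * d' / \<alpha> R'"
      unfolding E_def by (rule boundN(3))
    also have "\<dots> \<le> E * (b * d) / \<alpha> R'"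
      using dd E aR' by (intro divide_right_mono mult_left_mono) auto
    also have "\<dots> \<le> E * (b * d) / (\<alpha> R / C1)"
      using w1 C1 E ab dpos aR aR' by (intro divide_left_mono) (auto simp: field_simps)
    also have "\<dots> = B * (d / (2 * \<alpha> R))"
      using C1 by (simp add: B_def field_simps)
    also have "\<dots> \<le> B * ?dM x y"
      using boundM(2) E C1 ab by (intro mult_left_mono) (auto simp: B_def)
    finally show "?dN x y \<le> B * ?dM x y" .
    have "A * ?dM x y \<le> A * (E * d / \<alpha> R)"
      unfolding E_def using boundM(3) A by (intro mult_left_mono) auto
    also have "\<dots> = a * d / (2 * (C2 * \<alpha> R))"
      using E C2 by (simp add: A_def field_simps)
    also have "\<dots> \<le> a * d / (2 * \<alpha> R')"
      using w2 C2 ab dpos aR aR' by (intro divide_left_mono) auto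
    also have "\<dots> \<le> d' / (2 * \<alpha> R')"
      using dd aR' by (intro divide_right_mono) auto
    also have "\<dots> \<le> ?dN x y"
      by (rule boundN(2))
    finally show "A * ?dM x y \<le> ?dN x y" .
  qed
  have nonneg: "0 \<le> ?dM x y" for x y
    by (rule Metric_space.nonneg[OF Metric_space_dual])
  \<comment> \<open>Replacing \<open>B\<close> by \<open>max A B\<close> gives ordered constants at once.\<close>
  have "A * ?dM x y \<le> ?dN x y \<and> ?dN x y \<le> max A B * ?dM x y"
    if x: "x \<in> mspace M" and y: "y \<in> mspace M" for x y
  proof (cases "x = y")
    case True
    have "f z \<in> mspace N" "f y \<in> mspace N"
      using f z y by auto
    then show ?thesis
      using True by (simp add: mu_dist_self[OF z y] mu_dist_self)
  next
    case False
    have "B * ?dM x y \<le> max A B * ?dM x y"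
      using nonneg by (intro mult_right_mono) auto
    then show ?thesis
      using bounds[OF x y False] by linarith
  qed
  then show ?thesis
    using A by (intro exI[of _ A] exI[of _ "max A B"]) auto
qed

lemma bilipschitz_pointed_B_map:
  fixes M :: "'a metric" and N :: "'b metric"
  assumes z: "z \<in> mspace M" and f: "bilipschitz_pointed M z N z' f"
  shows "bilipschitz_pointed
    (B_space \<alpha> M z :: (('a \<Rightarrow> 'k::real_normed_field) \<Rightarrow> 'k) metric) (\<lambda>_. 0)
    (B_space \<alpha> N z' :: (('b \<Rightarrow> 'k) \<Rightarrow> 'k) metric) (\<lambda>_. 0)
    (B_map \<alpha> M z N z' f)"
proof -
  have fN: "f \<in> mspace M \<rightarrow> mspace N" and fz: "f z = z'"
    using f by (auto simp: bilipschitz_pointed_def bilipschitz_map_def)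
  then have z': "z' \<in> mspace N"
    using z by auto
  obtain a b where ab: "0 < a" "a \<le> b"
    and lower: "\<And>x y. x \<in> mspace M \<Longrightarrow> y \<in> mspace M \<Longrightarrow> a * mdist M x y \<le> mdist N (f x) (f y)"
    and upper: "\<And>x y. x \<in> mspace M \<Longrightarrow> y \<in> mspace M \<Longrightarrow> mdist N (f x) (f y) \<le> b * mdist M x y"
    using f unfolding bilipschitz_pointed_def bilipschitz_map_def by blast
  have "bilipschitz_map (B_space \<alpha> M z :: (('a \<Rightarrow> 'k) \<Rightarrow> 'k) metric) (B_space \<alpha> N z')
      (B_map \<alpha> M z N z' f)"
    unfolding bilipschitz_map_def
  proof
    show "B_map \<alpha> M z N z' f \<in> mspace (B_space \<alpha> M z :: (('a \<Rightarrow> 'k) \<Rightarrow> 'k) metric)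
        \<rightarrow> mspace (B_space \<alpha> N z')"
      unfolding mspace_B_space[OF z] mspace_B_space[OF z']
      using fN by (auto simp: B_map_mu[OF z])
    show "\<exists>A B. 0 < A \<and> A \<le> B \<and>
        (\<forall>\<phi>\<in>mspace (B_space \<alpha> M z :: (('a \<Rightarrow> 'k) \<Rightarrow> 'k) metric). \<forall>\<psi>\<in>mspace (B_space \<alpha> M z).
          A * mdist (B_space \<alpha> M z) \<phi> \<psi>
            \<le> mdist (B_space \<alpha> N z') (B_map \<alpha> M z N z' f \<phi>) (B_map \<alpha> M z N z' f \<psi>) \<and>
          mdist (B_space \<alpha> N z') (B_map \<alpha> M z N z' f \<phi>) (B_map \<alpha> M z N z' f \<psi>)
            \<le> B * mdist (B_space \<alpha> M z) \<phi> \<psi>)"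
      using mu_dist_distortion[OF fN z ab lower upper, where ?'k = 'k]
      by (simp add: mspace_B_space[OF z] B_map_mu[OF z] fz)
  qed
  moreover have "B_map \<alpha> M z N z' f (\<lambda>_. 0) = (\<lambda>_. 0 :: 'k)"
    using B_map_mu[OF z z, of N z' f, where ?'k = 'k] by (simp add: fz mu_base_point)
  ultimately show ?thesis
    by (simp add: bilipschitz_pointed_def)
qed

end

section \<open>Functoriality and preservation of bi-Lipschitz maps\<close>

lemma D_const_finite_imp_linear_growth:
  assumes pos: "\<alpha> \<in> {0<..} \<rightarrow> {0<..}" and fin: "D_const \<alpha> < \<infinity>"
  obtains D where "\<And>t. 0 < t \<Longrightarrow> t \<le> D * \<alpha> t"
proof -
  have le: "ereal (t / \<alpha> t) \<le> D_const \<alpha>" if "0 < t" for t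
    unfolding D_const_def using that by (intro SUP_upper) auto
  have "D_const \<alpha> \<noteq> -\<infinity>"
    using le[of 1] by auto
  then obtain D where D: "D_const \<alpha> = ereal D"
    using fin by (cases "D_const \<alpha>") auto
  have "t \<le> D * \<alpha> t" if "0 < t" for t
  proof -
    have "0 < \<alpha> t"
      using pos that by auto
    then show ?thesis
      using le[OF that] by (simp add: D field_simps)
  qed
  then show ?thesis
    by (rule that)
qed

theorem proposition2p13:
  fixes \<alpha> :: "real \<Rightarrow> real"
    and M :: "'a metric" and o\<^sub>M :: 'a
    and N :: "'b metric" and o\<^sub>N :: 'b
    and K :: "'c metric" and o\<^sub>K :: 'c
  assumes "\<alpha> \<in> {0<..} \<rightarrow> {0<..}"
    and "\<exists>L. L-lipschitz_on {0<..} \<alpha>"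
    and "D_const \<alpha> < \<infinity>"
    and "pointed_metric M o\<^sub>M" and "pointed_metric N o\<^sub>N" and "pointed_metric K o\<^sub>K"
  shows
    "(\<forall>f. bilipschitz_pointed M o\<^sub>M N o\<^sub>N f \<longrightarrow>
       (\<forall>x\<in>mspace M. B_map \<alpha> M o\<^sub>M N o\<^sub>N f (mu \<alpha> M o\<^sub>M x :: ('a \<Rightarrow> 'k::real_normed_field) \<Rightarrow> 'k)
                       = mu \<alpha> N o\<^sub>N (f x))) \<and>
     (\<forall>\<phi> :: ('a \<Rightarrow> 'k) \<Rightarrow> 'k. \<phi> \<in> mspace (B_space \<alpha> M o\<^sub>M) \<longrightarrow>
       B_map \<alpha> M o\<^sub>M M o\<^sub>M id \<phi> = \<phi>) \<and>
     (\<forall>g f. bilipschitz_pointed M o\<^sub>M N o\<^sub>N g \<and> bilipschitz_pointed N o\<^sub>N K o\<^sub>K f \<longrightarrow>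
       (\<forall>\<phi> :: ('a \<Rightarrow> 'k) \<Rightarrow> 'k. \<phi> \<in> mspace (B_space \<alpha> M o\<^sub>M) \<longrightarrow>
          B_map \<alpha> M o\<^sub>M K o\<^sub>K (f \<circ> g) \<phi> = B_map \<alpha> N o\<^sub>N K o\<^sub>K f (B_map \<alpha> M o\<^sub>M N o\<^sub>N g \<phi>))) \<and>
     (\<forall>f. bilipschitz_pointed M o\<^sub>M N o\<^sub>N f \<longrightarrow>
       bilipschitz_pointed
         (B_space \<alpha> M o\<^sub>M :: (('a \<Rightarrow> 'k) \<Rightarrow> 'k) metric) (\<lambda>_. 0)
         (B_space \<alpha> N o\<^sub>N :: (('b \<Rightarrow> 'k) \<Rightarrow> 'k) metric) (\<lambda>_. 0)
         (B_map \<alpha> M o\<^sub>M N o\<^sub>N f))"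
proof -
  obtain L where L: "L-lipschitz_on {0<..} \<alpha>"
    using assms(2) by blast
  obtain D where D: "\<And>t. 0 < t \<Longrightarrow> t \<le> D * \<alpha> t"
    using D_const_finite_imp_linear_growth[OF assms(1,3)] by blast
  interpret lipschitz_weight \<alpha> L D
    using assms(1) L D by unfold_locales auto
  have zM: "o\<^sub>M \<in> mspace M" and zN: "o\<^sub>N \<in> mspace N"
    using assms(4,5) by (auto simp: pointed_metric_def)
  have comp: "B_map \<alpha> M o\<^sub>M K o\<^sub>K (f \<circ> g) \<phi> = B_map \<alpha> N o\<^sub>N K o\<^sub>K f (B_map \<alpha> M o\<^sub>M N o\<^sub>N g \<phi>)"
    if g: "bilipschitz_pointed M o\<^sub>M N o\<^sub>N g" and mem: "\<phi> \<in> mspace (B_space \<alpha> M o\<^sub>M)"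
    for g f and \<phi> :: "('a \<Rightarrow> 'k) \<Rightarrow> 'k"
  proof -
    obtain x where x: "x \<in> mspace M" and \<phi>: "\<phi> = mu \<alpha> M o\<^sub>M x"
      using mem unfolding mspace_B_space[OF zM] by blast
    have "g x \<in> mspace N"
      using g x by (auto simp: bilipschitz_pointed_def bilipschitz_map_def)
    then show ?thesis
      by (simp add: \<phi> B_map_mu[OF zM x] B_map_mu[OF zN])
  qed
  show ?thesis
  proof (intro conjI allI impI ballI)
    fix f x
    assume "x \<in> mspace M"
    then show "B_map \<alpha> M o\<^sub>M N o\<^sub>N f (mu \<alpha> M o\<^sub>M x :: ('a \<Rightarrow> 'k) \<Rightarrow> 'k) = mu \<alpha> N o\<^sub>N (f x)"
      by (rule B_map_mu[OF zM])
  next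
    fix \<phi> :: "('a \<Rightarrow> 'k) \<Rightarrow> 'k"
    assume "\<phi> \<in> mspace (B_space \<alpha> M o\<^sub>M)"
    then show "B_map \<alpha> M o\<^sub>M M o\<^sub>M id \<phi> = \<phi>"
      unfolding mspace_B_space[OF zM] by (auto simp: B_map_mu[OF zM])
  qed (use comp bilipschitz_pointed_B_map[OF zM] in auto)
qed

end
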